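(* Let $k\geqslant 1$, $n\in\mathbb{Z}_{\geqslant 0}$, let $\overrightarrow{m}=(m_1,\ldots,m_k)$ be a multi-index of non-negative integers with $m=m_1+\ldots+m_k\neq 0$, and suppose that $n\geqslant\max\{m_j:1\leqslant j\leqslant k\}$. Put $n_j=n+m-m_j$. Let ${\bf f^{ch2}}=(f^{ch2}_1,\ldots,f^{ch2}_k)$ be a system of functions $$f^{ch2}_j(x)=\sum_{l=1}^\infty b^j_lU_l(x),\qquad U_l(x)=\frac{1}{\sqrt{1-x^2}}\sin(l\arccos x),$$ with real coefficients, the series converging for all $x\in[-1,1]$, and let ${\bf f^2}=(f^2_1,\ldots,f^2_k)$, $f^2_j(z)=\sum_{l=1}^\infty b^j_lz^l$, be the associated system of power series. Suppose that: 1) there exist (algebraic) Hermite--Jacobi approximations $\widehat{\pi}_j(z;{\bf f^2})=\widehat{P}_j(z;{\bf f^2})/\widehat{Q}_m(z;{\bf f^2})$, $j=1,\ldots,k$, for the multi-index $(n,\overrightarrow{m})$ and the system ${\bf f^2}$; 2) each power series $f^2_j$ has radius of convergence $R^2_j>1$; 3) the rational fractions $\widehat{\pi}_j(z;{\bf f^2})$, $j=1,\ldots,k$, have no poles in $\overline{D}=\{z:|z|\leqslant 1\}$. Then there exist nonlinear Hermite--Chebyshev approximations of the second kind $\widehat{\pi}^{ch2}_j(x;{\bf f^{ch2}})=\widehat{P}^{ch2}_j(x;{\bf f^{ch2}})/\widehat{Q}^{ch2}_m(x;{\bf f^{ch2}})$, $j=1,\ldots,k$, for the multi-index $(n,\overrightarrow{m})$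 and the system ${\bf f^{ch2}}$, and for their denominator and numerators the following representations are valid: $$\widehat{Q}^{ch2}_m(x;{\bf f^{ch2}})=\widehat{Q}_m(e^{i\arccos x};{\bf f^2})\cdot\overline{\widehat{Q}_m(e^{i\arccos x};{\bf f^2})},$$ $$\widehat{P}^{ch2}_j(x;{\bf f^{ch2}})=\frac{1}{\sqrt{1-x^2}}\,\mathrm{Im}\left\{\widehat{P}_j(e^{i\arccos x};{\bf f^2})\cdot\overline{\widehat{Q}_m(e^{i\arccos x};{\bf f^2})}\right\},$$ where the Hermite--Jacobi polynomials $\widehat{Q}_m(z;{\bf f^2})$, $\widehat{P}_j(z;{\bf f^2})$ coincide with Hermite--Pad\'e polynomials $Q_m(z;{\bf f^2})$, $P_j(z;{\bf f^2})$ and, in the case when the determinant $H_{n,\overrightarrow{m}}({\bf f^2})\neq 0$, are found (with a suitable choice of the normalizing factor) by the formulas $$\widehat{Q}_m(z;{\bf f^2})=D(n,\overrightarrow{m};z),\qquad \widehat{P}_j(z;{\bf f^2})=G_j(n,\overrightarrow{m};z),\quad j=1,\ldots,k,$$ where the determinants $D$ and $G_j$ are formed for the system ${\bf f}={\bf f^2}$.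
   Context: Throughout, $O(z^p)$ denotes a power series of the form $c_1z^p+c_2z^{p+1}+\ldots$, and $n_j=n+m-m_j$ with $m=m_1+\ldots+m_k$. The functions $U_l$ (Chebyshev polynomials of the second kind, indexed so that $U_l$ has degree $l-1$) are polynomials, with values at $x=\pm1$ understood accordingly. Nonlinear Hermite--Chebyshev approximations of the second kind for $(n,\overrightarrow{m})$ and ${\bf f^{ch2}}$ are rational fractions $\widehat{P}^{ch2}_j(x)/\widehat{Q}^{ch2}_m(x)$, $j=1,\ldots,k$, with a common denominator, where the polynomials $\widehat{Q}^{ch2}_m$ (not identically zero) and $\widehat{P}^{ch2}_j$, of degrees at most $m$ and $n_j$ respectively, are such that $$f^{ch2}_j(x)-\frac{\widehat{P}^{ch2}_j(x)}{\widehat{Q}^{ch2}_m(x)}=\sum_{l=n+m+1}^\infty\widehat{b}^j_lU_l(x),\quad j=1,\ldots,k\quad(x\in[-1,1]).$$ (Algebraic) Hermite--Jacobi approximations. For a system ${\bf f}=(f_1,\ldots,f_k)$ of power series $f_j(z)=\sum_{l=0}^\infty f^j_lz^l$, rational functions $\widehat{P}_j(z;{\bf f})/\widehat{Q}_m(z;{\bf f})$, $j=1,\ldots,k$, with a common denominator, where $\widehat{Q}_m$ (not identically zero) and $\widehat{P}_j$ are polynomials of degree at most $m$ and $n_j$ respectively (the Hermite--Jacobi polynomials), are called Hermite--Jacobi approximations for $(n,\overrightarrow{m})$ and ${\bf f}$ if $f_j(z)-\widehat{P}_j(z;{\bf f})/\widehat{Q}_m(z;{\bf f})=O(z^{n+m+1})$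 for $j=1,\ldots,k$. When the coefficients of the series are real, $\widehat{Q}_m,\widehat{P}_j$ are taken with real coefficients. Hermite--Pad\'e polynomials for $(n,\overrightarrow{m})$ and ${\bf f}$ are polynomials $Q_m(z;{\bf f})\not\equiv 0$, $\deg Q_m\leqslant m$, and $P_j(z;{\bf f})$, $\deg P_j\leqslant n_j$, such that $Q_m(z;{\bf f})f_j(z)-P_j(z;{\bf f})=O(z^{n+m+1})$ for $j=1,\ldots,k$. Determinants. Put $f^j_p=0$ for $p<0$. For $m_j\neq 0$ let $H^j$ be the $m_j\times m$ matrix whose $r$-th row ($1\leqslant r\leqslant m_j$) is $(f^j_{n-m_j+r},f^j_{n-m_j+r+1},\ldots,f^j_{n_j+r-1})$, and let $F^j$ be the $m_j\times(m+1)$ matrix whose $r$-th row is $(f^j_{n-m_j+r},f^j_{n-m_j+r+1},\ldots,f^j_{n_j+r})$. Let $H_{n,\overrightarrow{m}}({\bf f})$ be the determinant of the $m\times m$ matrix obtained by placing $H^1,\ldots,H^k$ one above the other in this order, and let $F_{n,\overrightarrow{m}}({\bf f})$ be the $m\times(m+1)$ matrix obtained by placing $F^1,\ldots,F^k$ one above the other in this order; blocks with $m_j=0$ are omitted. Define the rows of length $m+1$ $$E(z)=(z^m,\ z^{m-1},\ \ldots,\ z,\ 1),$$ $$E_{m_j}(z)=\Big(\sum_{l=0}^{n-m_j}f^j_lz^{m+l},\ \sum_{l=0}^{n-m_j+1}f^j_lz^{m+l-1},\ \ldots,\ \sum_{l=0}^{n_j}f^j_lz^l\Big).$$ $D(n,\overrightarrow{m};z)$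 and $G_j(n,\overrightarrow{m};z)$ denote the determinants of the square matrices obtained from $F_{n,\overrightarrow{m}}({\bf f})$ by adding, as the last row, $E(z)$ and $E_{m_j}(z)$ respectively. (For ${\bf f}={\bf f^2}$ one has $f^j_0=0$ and $f^j_l=b^j_l$ for $l\geqslant 1$.) Quotients are regarded as rational functions, i.e. removable singularities are removed. The representations of $\widehat{Q}^{ch2}_m$, $\widehat{P}^{ch2}_j$ are for $x\in[-1,1]$ (by continuity at $x=\pm1$ for $\widehat{P}^{ch2}_j$) and determine these polynomials. *)

theory Defs
  imports
    "HOL-Complex_Analysis.Complex_Analysis"
    "HOL-Computational_Algebra.Computational_Algebra"
    "Jordan_Normal_Form.Determinant"
begin

text \<open>
  Components of a system are indexed by \<open>j \<in> {1..k}\<close>, and \<open>ms j\<close> is the component \<open>m\<^sub>j\<close> of the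
  multi-index.  For \<open>j \<in> {1..k}\<close> one has \<open>ms j \<le> msum k ms\<close>, so the subtraction in
  \<open>numdeg\<close> does not truncate.
\<close>

definition msum :: "nat \<Rightarrow> (nat \<Rightarrow> nat) \<Rightarrow> nat" where
  "msum k ms = (\<Sum>j=1..k. ms j)"

definition numdeg :: "nat \<Rightarrow> nat \<Rightarrow> (nat \<Rightarrow> nat) \<Rightarrow> nat \<Rightarrow> nat" where
  "numdeg k n ms j = n + msum k ms - ms j"


text \<open>
  Chebyshev polynomials of the second kind, indexed so that \<open>chebU l\<close> has degree \<open>l - 1\<close>.
  The trigonometric formula on the open interval determines the polynomial, hence
  its values at \<open>1\<close> and \<open>-1\<close>; see \<open>chebU_eq\<close>.
\<close>

definition chebU :: "nat \<Rightarrow> real poly" where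
  "chebU l = (THE p. \<forall>x\<in>{-1<..<1}. poly p x = sin (real l * arccos x) / sqrt (1 - x\<^sup>2))"

lemma chebU_exists:
  "\<exists>p. \<forall>x\<in>{-1<..<1::real}. poly p x = sin (real l * arccos x) / sqrt (1 - x\<^sup>2)"
proof (induction l rule: nat_less_induct)
  case (1 l)
  consider "l = 0" | "l = 1" | i where "l = Suc (Suc i)"
    by (metis One_nat_def not0_implies_Suc)
  then show ?case
  proof cases
    case 1
    then show ?thesis by (intro exI[of _ 0]) simp
  next
    case 2
    have "sqrt (1 - x\<^sup>2) \<noteq> 0" if "x \<in> {-1<..<1}" for x :: real
      using that by (auto simp: power2_eq_1_iff)
    then show ?thesis using 2 by (intro exI[of _ 1]) (auto simp: sin_arccos)
  next
    case (3 i)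
    obtain p where p: "\<forall>x\<in>{-1<..<1}. poly p x = sin (real (Suc i) * arccos x) / sqrt (1 - x\<^sup>2)"
      using "1.IH" 3 by blast
    obtain q where q: "\<forall>x\<in>{-1<..<1}. poly q x = sin (real i * arccos x) / sqrt (1 - x\<^sup>2)"
      using "1.IH" 3 by (metis lessI less_SucI)
    have "poly ([:0, 2:] * p - q) x = sin (real l * arccos x) / sqrt (1 - x\<^sup>2)"
      if x: "x \<in> {-1<..<1}" for x
    proof -
      define t where "t = arccos x"
      have c: "cos t = x" using x by (simp add: t_def)
      have "sin (real l * t) = sin (real (Suc i) * t + t)"
        using 3 by (simp add: algebra_simps)
      moreover have "sin (real i * t) = sin (real (Suc i) * t - t)"
        by (simp add: algebra_simps)
      ultimately have "sin (real l * t) = 2 * x * sin (real (Suc i) * t) - sin (real i * t)"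
        unfolding sin_add sin_diff c by simp
      then show ?thesis
        using p q x unfolding t_def by (simp add: diff_divide_distrib)
    qed
    then show ?thesis by blast
  qed
qed

lemma chebU_eq:
  assumes "x \<in> {-1<..<1}"
  shows "poly (chebU l) x = sin (real l * arccos x) / sqrt (1 - x\<^sup>2)"
proof -
  have "\<exists>!p. \<forall>x\<in>{-1<..<1}. poly p x = sin (real l * arccos x) / sqrt (1 - x\<^sup>2)"
  proof (rule ex_ex1I[OF chebU_exists])
    fix p q :: "real poly"
    assume "\<forall>x\<in>{-1<..<1}. poly p x = sin (real l * arccos x) / sqrt (1 - x\<^sup>2)"
      and "\<forall>x\<in>{-1<..<1}. poly q x = sin (real l * arccos x) / sqrt (1 - x\<^sup>2)"
    then have "{-1<..<1::real} \<subseteq> {x. poly (p - q) x = 0}" by auto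
    moreover have "infinite {-1<..<1::real}" by simp
    ultimately show "p = q"
      using poly_roots_finite[of "p - q"] finite_subset by (metis right_minus_eq)
  qed
  from theI'[OF this] show ?thesis using assms unfolding chebU_def by blast
qed


text \<open>
  The quotient \<open>P j / Q\<close> is formed in the field of formal Laurent series because \<open>Q\<close> may vanish
  at \<open>0\<close>.
\<close>

definition hermite_jacobi ::
  "nat \<Rightarrow> nat \<Rightarrow> (nat \<Rightarrow> nat) \<Rightarrow> (nat \<Rightarrow> real fps) \<Rightarrow> real poly \<Rightarrow> (nat \<Rightarrow> real poly) \<Rightarrow> bool" where
  "hermite_jacobi k n ms f Q P \<longleftrightarrow>
     Q \<noteq> 0 \<and> degree Q \<le> msum k ms \<and>
     (\<forall>j\<in>{1..k}. degree (P j) \<le> numdeg k n ms j \<and>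
        (\<exists>g. fps_to_fls (f j) - fps_to_fls (fps_of_poly (P j)) / fps_to_fls (fps_of_poly Q)
             = fps_to_fls (fps_X ^ (n + msum k ms + 1) * g)))"

definition hermite_pade ::
  "nat \<Rightarrow> nat \<Rightarrow> (nat \<Rightarrow> nat) \<Rightarrow> (nat \<Rightarrow> real fps) \<Rightarrow> real poly \<Rightarrow> (nat \<Rightarrow> real poly) \<Rightarrow> bool" where
  "hermite_pade k n ms f Q P \<longleftrightarrow>
     Q \<noteq> 0 \<and> degree Q \<le> msum k ms \<and>
     (\<forall>j\<in>{1..k}. degree (P j) \<le> numdeg k n ms j \<and>
        (\<exists>g. fps_of_poly Q * f j - fps_of_poly (P j) = fps_X ^ (n + msum k ms + 1) * g))"

text \<open>
  The value at \<open>x\<close> of the rational function \<open>P j / Q\<close>, with removable singularities removed, is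
  expressed as the limit \<open>v\<close> of the quotient at \<open>x\<close>.  Existence of this limit says that
  \<open>P j / Q\<close> has no pole at \<open>x\<close>.
\<close>

definition hermite_chebyshev2 ::
  "nat \<Rightarrow> nat \<Rightarrow> (nat \<Rightarrow> nat) \<Rightarrow> (nat \<Rightarrow> real \<Rightarrow> real) \<Rightarrow> real poly \<Rightarrow> (nat \<Rightarrow> real poly) \<Rightarrow> bool" where
  "hermite_chebyshev2 k n ms f Q P \<longleftrightarrow>
     Q \<noteq> 0 \<and> degree Q \<le> msum k ms \<and>
     (\<forall>j\<in>{1..k}. degree (P j) \<le> numdeg k n ms j \<and>
        (\<exists>c :: nat \<Rightarrow> real. \<forall>x\<in>{-1..1}. \<exists>v. ((\<lambda>t. poly (P j) t / poly Q t) \<longlongrightarrow> v) (at x) \<and>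
           (\<lambda>i. let l = n + msum k ms + 1 + i in c l * poly (chebU l) x) sums (f j x - v)))"


text \<open>
  Rows of the determinants, with columns numbered by \<open>c = 0, 1, \<dots>\<close>.  The coefficient function
  \<open>fls_nth\<close> of a power series is \<open>0\<close> at negative indices.  A block with \<open>ms j = 0\<close> contributes no
  rows.
\<close>

definition coeff_rows :: "nat \<Rightarrow> nat \<Rightarrow> (nat \<Rightarrow> nat) \<Rightarrow> (nat \<Rightarrow> real fps) \<Rightarrow> nat \<Rightarrow> real list list" where
  "coeff_rows k n ms f w =
     [[fls_nth (fps_to_fls (f j)) (int n - int (ms j) + int r + int c). c \<leftarrow> [0..<w]].
        j \<leftarrow> [1..<k+1], r \<leftarrow> [1..<ms j + 1]]"

definition H_det :: "nat \<Rightarrow> nat \<Rightarrow> (nat \<Rightarrow> nat) \<Rightarrow> (nat \<Rightarrow> real fps) \<Rightarrow> real" where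
  "H_det k n ms f =
     Determinant.det (mat_of_rows_list (msum k ms) (coeff_rows k n ms f (msum k ms)))"

definition bordered_det ::
  "nat \<Rightarrow> nat \<Rightarrow> (nat \<Rightarrow> nat) \<Rightarrow> (nat \<Rightarrow> real fps) \<Rightarrow> real poly list \<Rightarrow> real poly" where
  "bordered_det k n ms f e =
     Determinant.det (mat_of_rows_list (msum k ms + 1)
       (map (map (\<lambda>a. [:a:])) (coeff_rows k n ms f (msum k ms + 1)) @ [e]))"

definition D_det :: "nat \<Rightarrow> nat \<Rightarrow> (nat \<Rightarrow> nat) \<Rightarrow> (nat \<Rightarrow> real fps) \<Rightarrow> real poly" where
  "D_det k n ms f =
     bordered_det k n ms f [monom 1 (msum k ms - c). c \<leftarrow> [0..<msum k ms + 1]]"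

definition G_det :: "nat \<Rightarrow> nat \<Rightarrow> (nat \<Rightarrow> nat) \<Rightarrow> (nat \<Rightarrow> real fps) \<Rightarrow> nat \<Rightarrow> real poly" where
  "G_det k n ms f j =
     bordered_det k n ms f
       [\<Sum>l | int l \<le> int n - int (ms j) + int c. monom (fps_nth (f j) l) (msum k ms - c + l).
          c \<leftarrow> [0..<msum k ms + 1]]"


text \<open>Evaluation of a real polynomial at a complex point.\<close>

definition cpoly :: "real poly \<Rightarrow> complex \<Rightarrow> complex" where
  "cpoly p z = poly (map_poly complex_of_real p) z"

end

theory Submission
  imports Defs "HOL-Computational_Algebra.Field_as_Ring"
begin

text \<open>
  Write \<open>x = cos t\<close> and \<open>z = cis t\<close>, so that \<open>sin t * U\<^sub>l(x) = Im (z ^ l)\<close>.  A power series \<open>R\<close> with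
  real coefficients \<open>r\<^sub>l\<close> that converges on the unit circle therefore satisfies
  \<open>Im (R z) = sin t * (\<Sum>l. r\<^sub>l U\<^sub>l(x))\<close>: restricting to the circle and taking imaginary parts
  turns a power series into the Chebyshev series with the same coefficients.  Under this map a quotient
  of polynomials becomes \<open>Im (P/Q) / sin t = (Im (P * cnj Q) / sin t) / (Q * cnj Q)\<close>.  Numerator
  and denominator on the right are polynomials in \<open>x\<close>, called \<open>chebIm P Q\<close> and \<open>chebRe Q Q\<close>
  below, because products of exponentials \<open>z ^ a * cnj z ^ b\<close> have imaginary part
  \<open>sin ((a - b) t)\<close> and real part \<open>cos ((a - b) t)\<close>.  Their degrees are at most
  \<open>max (deg P) (deg Q)\<close> and \<open>deg Q\<close>; the assumption \<open>n \<ge> m\<^sub>j\<close> makes \<open>m \<le> n\<^sub>j\<close> and thus keeps the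
  numerator within the allowed degree.

  The power series of \<open>P\<^sub>j/Q\<close> agrees with \<open>f2 j\<close> up to order \<open>n + m\<close>, so the error of the new
  approximation is a series in \<open>U\<^sub>l\<close> with \<open>l > n + m\<close>.  What has to be checked is that the power
  series of \<open>P\<^sub>j/Q\<close> may be evaluated on the circle.  Absence of poles makes its radius of
  convergence larger than \<open>1\<close>, but \<open>P\<^sub>j\<close> and \<open>Q\<close> may have common zeros in the disk, and even on the
  circle, where the denominator \<open>chebRe Q Q\<close> then vanishes.  The greatest common divisor \<open>S\<close> is
  therefore split off: \<open>chebRe S S\<close> is a common factor of the new numerator and denominator
  (\<open>chebRe_mult\<close>, \<open>chebIm_mult\<close>), and the reduced denominator has no zero in the closed disk.
  \<open>reduced_quotient_chebU_series\<close> combines these steps.  At \<open>x = 1\<close> and \<open>x = -1\<close>, where \<open>sin t\<close>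
  vanishes, the identity follows by continuity, the series being uniformly convergent because
  \<open>|U\<^sub>l| \<le> l\<close> on \<open>[-1,1]\<close> while the \<open>r\<^sub>l\<close> decay geometrically.

  Multiplication by \<open>Q\<close> turns the Hermite-Jacobi condition into the Hermite-Pade condition.  For
  the determinants, let \<open>q\<close> be the vector of coefficients of \<open>Q\<close>, highest power first.  Vanishing
  of the coefficients of \<open>Q * f2 j\<close> at the \<open>m\<^sub>j\<close> powers following \<open>n\<^sub>j\<close> says that \<open>q\<close> is annihilated
  by the matrix \<open>F\<close> with the rows \<open>coeff_rows\<close>.  If a row \<open>e\<close> is added below \<open>F\<close>, the product with \<open>q\<close> has
  only its last entry \<open>e \<bullet> q\<close> left, and Cramer's rule for the last unknown reads
  \<open>Q(0) * det = H * (e \<bullet> q)\<close> (\<open>bordered_det_kernel_vector\<close>).  For the rows \<open>E\<close> and \<open>E\<^sub>m\<^sub>j\<close> the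
  scalar \<open>e \<bullet> q\<close> is \<open>Q\<close> and \<open>P\<^sub>j\<close>, so all polynomials are the determinants up to the common factor
  \<open>Q(0) / H\<close>.
\<close>

section \<open>Chebyshev polynomials of both kinds\<close>

lemma poly_eqI_cos_interior:
  fixes p q :: "real poly"
  assumes "\<And>t. t \<in> {0<..<pi} \<Longrightarrow> poly p (cos t) = poly q (cos t)"
  shows "p = q"
proof (rule ccontr)
  assume "p \<noteq> q"
  have "poly (p - q) x = 0" if "x \<in> {-1<..<1}" for x
    using assms[of "arccos x"] that arccos_lt_bounded[of x] by simp
  then have "{-1<..<1} \<subseteq> {x. poly (p - q) x = 0}" by blast
  then have "finite {-1<..<1::real}"
    using poly_roots_finite[of "p - q"] \<open>p \<noteq> q\<close> finite_subset by auto
  then show False using infinite_Ioo[of "-1" "1::real"] by simp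
qed

lemma chebU_cos_interior:
  assumes "t \<in> {0<..<pi}"
  shows "sin t * poly (chebU l) (cos t) = sin (real l * t)"
proof -
  have s: "sin t > 0" using assms by (auto intro: sin_gt_zero)
  have "cos t \<in> {-1<..<1}"
    using cos_monotone_0_pi[of 0 t] cos_monotone_0_pi[of t pi] assms by auto
  moreover have "sqrt (1 - (cos t)\<^sup>2) = sin t"
    using s by (simp add: sin_squared_eq [symmetric])
  ultimately show ?thesis
    using chebU_eq[of "cos t" l] s assms by (simp add: arccos_cos)
qed

text \<open>
  Chebyshev polynomials of the first kind.  They express \<open>Re (P * cnj Q)\<close> on the circle, and
  they link consecutive \<open>chebU\<close>, which makes all properties of the latter provable by induction.
\<close>

fun chebT :: "nat \<Rightarrow> real poly" where
  "chebT 0 = 1"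
| "chebT (Suc 0) = [:0, 1:]"
| "chebT (Suc (Suc l)) = [:0, 2:] * chebT (Suc l) - chebT l"

lemma poly_chebT_cos: "poly (chebT l) (cos t) = cos (real l * t)"
proof (induction l rule: chebT.induct)
  case (3 l)
  have "cos (real (Suc (Suc l)) * t) = cos (real (Suc l) * t + t)"
    and "cos (real l * t) = cos (real (Suc l) * t - t)"
    by (simp_all add: algebra_simps)
  then have "cos (real (Suc (Suc l)) * t) = 2 * cos t * cos (real (Suc l) * t) - cos (real l * t)"
    unfolding cos_add cos_diff by simp
  then show ?case using 3 by simp
qed simp_all

lemma degree_chebT: "degree (chebT l) \<le> l"
proof (induction l rule: chebT.induct)
  case (3 l)
  have "degree ([:0, 2:] * chebT (Suc l)) \<le> Suc (Suc l)"
    using degree_mult_le[of "[:0, 2:]" "chebT (Suc l)"] 3 by simp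
  then show ?case using 3 by (simp add: degree_diff_le)
qed simp_all

lemma chebU_0 [simp]: "chebU 0 = 0"
  by (rule poly_eqI_cos_interior) (use chebU_cos_interior[of _ 0] in \<open>force simp: sin_zero_pi_iff\<close>)

text \<open>
  The addition theorem for \<open>sin (l t + t)\<close>.  An identity between polynomials in \<open>x\<close>, unlike
  the trigonometric formula, remains usable at \<open>x = 1\<close> and \<open>x = -1\<close>.
\<close>

lemma chebU_Suc: "chebU (Suc l) = [:0, 1:] * chebU l + chebT l"
proof (rule poly_eqI_cos_interior)
  fix t :: real assume t: "t \<in> {0<..<pi}"
  then have s: "sin t > 0" by (auto intro: sin_gt_zero)
  have "sin t * poly (chebU (Suc l)) (cos t) = sin (real l * t + t)"
    using chebU_cos_interior[OF t, of "Suc l"] by (simp add: algebra_simps)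
  also have "\<dots> = sin t * poly ([:0, 1:] * chebU l + chebT l) (cos t)"
    using chebU_cos_interior[OF t, of l] by (simp add: sin_add poly_chebT_cos algebra_simps)
  finally show "poly (chebU (Suc l)) (cos t) = poly ([:0, 1:] * chebU l + chebT l) (cos t)"
    using s by simp
qed

lemma sin_mult_poly_chebU_cos: "sin t * poly (chebU l) (cos t) = sin (real l * t)"
proof (induction l)
  case (Suc l)
  have "sin t * poly (chebU (Suc l)) (cos t)
      = cos t * (sin t * poly (chebU l) (cos t)) + sin t * cos (real l * t)"
    by (simp add: chebU_Suc poly_chebT_cos algebra_simps)
  also have "\<dots> = sin (real (Suc l) * t)"
    unfolding Suc by (simp add: algebra_simps sin_add)
  finally show ?case .
qed simp

lemma degree_chebU: "degree (chebU l) \<le> l"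
proof (induction l)
  case (Suc l)
  have "degree ([:0, 1:] * chebU l) \<le> Suc l"
    using degree_mult_le[of "[:0, 1:]" "chebU l"] Suc by simp
  then show ?case using degree_chebT[of l] by (simp add: chebU_Suc degree_add_le)
qed simp

text \<open>
  One step of \<open>chebU_Suc\<close> multiplies by \<open>x\<close> and adds a cosine, so it increases the absolute
  value by at most \<open>1\<close>.  The bound serves as majorant in the M-test.
\<close>

lemma abs_poly_chebU_le:
  assumes "x \<in> {-1..1}"
  shows "\<bar>poly (chebU l) x\<bar> \<le> real l"
proof (induction l)
  case (Suc l)
  have "\<bar>poly (chebT l) x\<bar> \<le> 1"
    using poly_chebT_cos[of l "arccos x"] assms by simp
  moreover have "\<bar>x * poly (chebU l) x\<bar> \<le> \<bar>poly (chebU l) x\<bar>"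
    using assms by (auto simp: abs_mult intro: mult_left_le_one_le)
  ultimately show ?case using Suc by (simp add: chebU_Suc)
qed simp

section \<open>Boundary values of a polynomial times a conjugate\<close>

lemma cpoly_0 [simp]: "cpoly 0 z = 0"
  and cpoly_pCons [simp]: "cpoly (pCons a p) z = of_real a + z * cpoly p z"
  by (simp_all add: cpoly_def map_poly_pCons)

lemma cpoly_add: "cpoly (p + q) z = cpoly p z + cpoly q z"
proof (induction p arbitrary: q)
  case (pCons a p)
  then show ?case by (cases q) (simp add: algebra_simps)
qed simp

lemma cpoly_smult: "cpoly (Polynomial.smult c p) z = of_real c * cpoly p z"
  by (induction p) (simp_all add: algebra_simps)

lemma cpoly_mult: "cpoly (p * q) z = cpoly p z * cpoly q z"
  by (induction p) (simp_all add: cpoly_add cpoly_smult algebra_simps)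

lemma cpoly_altdef: "cpoly p z = (\<Sum>a\<le>degree p. of_real (coeff p a) * z ^ a)"
  by (simp add: cpoly_def poly_altdef coeff_map_poly degree_map_poly)

lemma isCont_cpoly: "isCont (cpoly p) z"
  unfolding cpoly_def[abs_def] by simp

lemma finite_zeros_cpoly:
  assumes "p \<noteq> 0"
  shows "finite {z. cpoly p z = 0}"
  unfolding cpoly_def using assms by (intro poly_roots_finite) (simp add: map_poly_eq_0_iff)

text \<open>
  With \<open>z = cis t\<close>, these are \<open>Re (A z * cnj (B z))\<close> and \<open>Im (A z * cnj (B z)) / sin t\<close> as
  polynomials in \<open>cos t\<close>, see \<open>poly_chebRe\<close> and \<open>poly_chebIm\<close>.  The case distinctions take
  absolute values of \<open>a - b\<close>, using that the cosine is even and the sine odd.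
\<close>

definition chebRe :: "real poly \<Rightarrow> real poly \<Rightarrow> real poly" where
  "chebRe A B = (\<Sum>a\<le>degree A. \<Sum>b\<le>degree B.
     Polynomial.smult (coeff A a * coeff B b) (chebT (if b \<le> a then a - b else b - a)))"

definition chebIm :: "real poly \<Rightarrow> real poly \<Rightarrow> real poly" where
  "chebIm A B = (\<Sum>a\<le>degree A. \<Sum>b\<le>degree B.
     Polynomial.smult (coeff A a * coeff B b) (if b \<le> a then chebU (a - b) else - chebU (b - a)))"

lemma cpoly_cis_mult_cnj:
  "cpoly A (cis t) * cnj (cpoly B (cis t))
     = (\<Sum>a\<le>degree A. \<Sum>b\<le>degree B. of_real (coeff A a * coeff B b) * cis ((real a - real b) * t))"
proof -
  have "of_real u * cis t ^ a * cnj (of_real v * cis t ^ b)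
      = of_real (u * v) * cis ((real a - real b) * t)" for a b u v
  proof -
    have "cis t ^ a * cnj (cis t ^ b) = cis ((real a - real b) * t)"
      by (simp add: Complex.DeMoivre cis_cnj cis_mult algebra_simps)
    then show ?thesis by (simp add: mult_ac)
  qed
  then show ?thesis
    unfolding cpoly_altdef cnj_sum sum_product by (intro sum.cong refl) simp
qed

lemma poly_chebRe: "poly (chebRe A B) (cos t) = Re (cpoly A (cis t) * cnj (cpoly B (cis t)))"
proof -
  have "poly (chebT (if b \<le> a then a - b else b - a)) (cos t) = cos ((real a - real b) * t)" for a b
    using cos_minus[of "(real a - real b) * t"] by (simp add: poly_chebT_cos algebra_simps of_nat_diff)
  then show ?thesis
    by (simp add: cpoly_cis_mult_cnj chebRe_def poly_sum Re_sum)
qed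

lemma poly_chebIm:
  "sin t * poly (chebIm A B) (cos t) = Im (cpoly A (cis t) * cnj (cpoly B (cis t)))"
proof -
  have "sin t * poly (if b \<le> a then chebU (a - b) else - chebU (b - a)) (cos t)
      = sin ((real a - real b) * t)" for a b
    using sin_minus[of "(real a - real b) * t"]
    by (simp add: sin_mult_poly_chebU_cos algebra_simps of_nat_diff)
  then have "sin t * (c * poly (if b \<le> a then chebU (a - b) else - chebU (b - a)) (cos t))
      = c * sin ((real a - real b) * t)" for a b c
    by (metis mult.left_commute)
  then show ?thesis
    unfolding cpoly_cis_mult_cnj chebIm_def poly_sum Im_sum sum_distrib_left poly_smult
    by (intro sum.cong refl) simp
qed

lemma poly_chebIm_arccos:
  assumes "x \<in> {-1<..<1}"
  shows "poly (chebIm A B) x =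
    1 / sqrt (1 - x\<^sup>2) * Im (cpoly A (cis (arccos x)) * cnj (cpoly B (cis (arccos x))))"
proof -
  have "sin (arccos x) = sqrt (1 - x\<^sup>2)" using assms by (simp add: sin_arccos)
  moreover have "sqrt (1 - x\<^sup>2) \<noteq> 0" using assms by (auto simp: power2_eq_1_iff)
  ultimately show ?thesis
    unfolding poly_chebIm [symmetric] using assms by simp
qed

lemma poly_chebRe_self: "poly (chebRe A A) (cos t) = (cmod (cpoly A (cis t)))\<^sup>2"
  by (simp only: poly_chebRe complex_norm_square [symmetric] of_real_power[symmetric] Re_complex_of_real)

text \<open>
  On the circle a common factor \<open>S\<close> contributes the real number \<open>|S z|\<^sup>2\<close> to \<open>A * cnj B\<close>.
  This and the next lemma let common zeros of numerator and denominator be cancelled.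
\<close>

lemma chebRe_mult: "chebRe (S * A) (S * A) = chebRe S S * chebRe A A"
proof (rule poly_eqI_cos_interior)
  fix t :: real
  show "poly (chebRe (S * A) (S * A)) (cos t) = poly (chebRe S S * chebRe A A) (cos t)"
    by (simp add: poly_chebRe_self cpoly_mult norm_mult power_mult_distrib)
qed

lemma chebIm_mult: "chebIm (S * A) (S * B) = chebRe S S * chebIm A B"
proof (rule poly_eqI_cos_interior)
  fix t :: real assume t: "t \<in> {0<..<pi}"
  have "sin t * poly (chebIm (S * A) (S * B)) (cos t)
      = Im ((cpoly S (cis t) * cnj (cpoly S (cis t))) * (cpoly A (cis t) * cnj (cpoly B (cis t))))"
    unfolding poly_chebIm cpoly_mult by (simp only: complex_cnj_mult mult_ac)
  also have "\<dots> = poly (chebRe S S) (cos t) * Im (cpoly A (cis t) * cnj (cpoly B (cis t)))"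
    unfolding poly_chebRe complex_norm_square [symmetric] Re_complex_of_real of_real_power[symmetric]
    by simp
  also have "\<dots> = sin t * poly (chebRe S S * chebIm A B) (cos t)"
    unfolding poly_chebIm [symmetric] by simp
  finally show "poly (chebIm (S * A) (S * B)) (cos t) = poly (chebRe S S * chebIm A B) (cos t)"
    using t sin_gt_zero[of t] by simp
qed

lemma degree_chebRe: "degree (chebRe A B) \<le> max (degree A) (degree B)"
  unfolding chebRe_def
  by (intro degree_sum_le finite_atMost order_trans[OF degree_smult_le] order_trans[OF degree_chebT])
    auto

lemma degree_chebIm: "degree (chebIm A B) \<le> max (degree A) (degree B)"
proof -
  have "degree (if b \<le> a then chebU (a - b) else - chebU (b - a)) \<le> max (degree A) (degree B)"
    if "a \<le> degree A" "b \<le> degree B" for a b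
    using that degree_chebU[of "a - b"] degree_chebU[of "b - a"] by auto
  then show ?thesis
    unfolding chebIm_def
    by (intro degree_sum_le finite_atMost order_trans[OF degree_smult_le]) (simp only: atMost_iff)
qed

text \<open>
  Otherwise \<open>A\<close> would vanish on the whole unit circle.
\<close>

lemma chebRe_self_neq_0:
  assumes "A \<noteq> 0"
  shows "chebRe A A \<noteq> 0"
proof
  assume "chebRe A A = 0"
  then have "cpoly A (cis t) = 0" for t
    using poly_chebRe_self[of A t] by simp
  then have "x \<in> Re ` {z. cpoly A z = 0}" if "x \<in> {-1<..<1}" for x
    using that by (intro image_eqI[of _ _ "cis (arccos x)"]) auto
  then have "finite {-1<..<1::real}"
    using finite_zeros_cpoly[OF assms] by (meson finite_imageI finite_subset subsetI)
  then show False using infinite_Ioo[of "-1" "1::real"] by simp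
qed

section \<open>Chebyshev series of a rational function without poles in the closed disk\<close>

text \<open>
  By Bezout, coprime \<open>A\<close> and \<open>B\<close> have no common zero, so a zero of \<open>B\<close> is a genuine pole of
  the quotient, which a common factor \<open>S\<close> does not change near \<open>z\<close>.
\<close>

lemma no_pole_imp_reduced_denominator_neq_0:
  assumes "coprime A B" "S \<noteq> 0" "B \<noteq> 0"
    and no_pole: "\<not> is_pole (\<lambda>w. cpoly (S * A) w / cpoly (S * B) w) z"
  shows "cpoly B z \<noteq> 0"
proof
  assume B0: "cpoly B z = 0"
  define u where "u = fst (bezout_coefficients A B)"
  define v where "v = snd (bezout_coefficients A B)"
  have "u * A + v * B = 1"
    using \<open>coprime A B\<close> bezout_coefficients_fst_snd[of A B] by (simp add: u_def v_def)
  then have "cpoly (u * A + v * B) z = 1" by (simp add: one_pCons)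
  then have A0: "cpoly A z \<noteq> 0" using B0 by (auto simp: cpoly_add cpoly_mult)
  have ev: "\<forall>\<^sub>F w in at z. cpoly p w \<noteq> 0" if "p \<noteq> 0" for p
  proof -
    have "\<forall>\<^sub>F w in at z. w \<notin> {w. cpoly p w = 0}"
      using islimpt_finite[OF finite_zeros_cpoly[OF that]] by (simp add: islimpt_iff_eventually)
    then show ?thesis by simp
  qed
  have "filterlim (cpoly B) (at 0) (at z)"
    using isCont_cpoly[of z B] ev[OF \<open>B \<noteq> 0\<close>] B0 by (intro filterlim_atI) (auto simp: isCont_def)
  then have "is_pole (\<lambda>w. cpoly A w / cpoly B w) z"
    unfolding is_pole_def using isCont_cpoly[of z A] A0
    by (intro filterlim_divide_at_infinity[where c = "cpoly A z"]) (auto simp: isCont_def)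
  moreover have ev_eq: "\<forall>\<^sub>F w in at z. cpoly A w / cpoly B w = cpoly (S * A) w / cpoly (S * B) w"
    using ev[OF \<open>S \<noteq> 0\<close>] by eventually_elim (simp add: cpoly_mult)
  ultimately show False
    using no_pole is_pole_transform[OF _ ev_eq refl] by blast
qed

text \<open>
  The finitely many zeros of \<open>B\<close> all lie outside the closed unit disk, hence outside a
  strictly larger one, in which \<open>A / B\<close> is holomorphic.
\<close>

lemma fps_quotient_beyond_unit_disk:
  assumes R: "R * fps_of_poly B = fps_of_poly A"
    and nz: "\<And>z. cmod z \<le> 1 \<Longrightarrow> cpoly B z \<noteq> 0"
  defines "Rc \<equiv> Abs_fps (\<lambda>l. complex_of_real (fps_nth R l))"
  shows "fps_conv_radius Rc > 1"
    and "cmod z \<le> 1 \<Longrightarrow> eval_fps Rc z * cpoly B z = cpoly A z"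
proof -
  define Ac where "Ac = fps_of_poly (map_poly complex_of_real A)"
  define Bc where "Bc = fps_of_poly (map_poly complex_of_real B)"
  have Rc: "Rc * Bc = Ac"
  proof (rule fps_ext)
    fix l
    have "fps_nth (Rc * Bc) l = of_real (fps_nth (R * fps_of_poly B) l)"
      by (simp add: fps_mult_nth Rc_def Bc_def coeff_map_poly)
    then show "fps_nth (Rc * Bc) l = fps_nth Ac l"
      by (simp add: R Ac_def coeff_map_poly)
  qed
  have eval: "eval_fps Ac w = cpoly A w" "eval_fps Bc w = cpoly B w" for w
    by (simp_all add: Ac_def Bc_def cpoly_def)
  have B0: "cpoly B 0 \<noteq> 0" using nz[of 0] by simp
  then have Bc0: "fps_nth Bc 0 \<noteq> 0"
    using eval(2)[of 0] by (simp add: eval_fps_at_0)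
  then have quot: "Ac / Bc = Rc"
    using Rc by (metis fps_nonzero_nth nonzero_mult_div_cancel_right)
  \<comment> \<open>The radius \<open>2\<close> only covers the case that \<open>B\<close> has no zeros; any number above \<open>1\<close> would do.\<close>
  define r where "r = Min (insert 2 (cmod ` {z. cpoly B z = 0}))"
  have fin: "finite (cmod ` {z. cpoly B z = 0})"
    using finite_zeros_cpoly[of B] B0 by (cases "B = 0") auto
  have "r > 1"
    unfolding r_def using fin nz by (subst Min_gr_iff) (auto simp: not_le [symmetric])
  have "cpoly B w \<noteq> 0" if "cmod w < r" for w
  proof
    assume "cpoly B w = 0"
    then have "r \<le> cmod w" unfolding r_def using fin by (intro Min_le) auto
    then show False using that by simp
  qed
  then have "fps_conv_radius (Ac / Bc) \<ge> Min {ereal r, fps_conv_radius Ac, fps_conv_radius Bc}"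
    using Bc0 \<open>r > 1\<close> 
    by (intro fps_conv_radius_divide) (simp_all add: eval subdegree_eq_0_iff, simp_all add: Ac_def Bc_def)
  then have "fps_conv_radius Rc \<ge> ereal r"
    unfolding quot by (simp add: Ac_def Bc_def)
  moreover have "ereal r > 1" using \<open>r > 1\<close> by simp
  ultimately show radius: "fps_conv_radius Rc > 1" by (rule less_le_trans[rotated])
  assume "cmod z \<le> 1"
  then have "ereal (cmod z) \<le> 1" by (simp add: one_ereal_def)
  then have "ereal (cmod z) < fps_conv_radius Rc" using radius by (rule le_less_trans)
  then have "eval_fps (Rc * Bc) z = eval_fps Rc z * eval_fps Bc z"
    by (intro eval_fps_mult) (simp_all add: Bc_def)
  then show "eval_fps Rc z * cpoly B z = cpoly A z"
    by (simp add: Rc eval)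
qed

text \<open>
  The imaginary part of the power series of \<open>A / B\<close> on the unit circle.  Dividing by \<open>sin t\<close>
  proves the claim inside the interval; both sides are continuous on the closed interval, which
  gives the end points.
\<close>

lemma chebU_series_of_quotient:
  assumes R: "R * fps_of_poly B = fps_of_poly A"
    and nz: "\<And>z. cmod z \<le> 1 \<Longrightarrow> cpoly B z \<noteq> 0"
    and x: "x \<in> {-1..1}"
  shows "poly (chebRe B B) x \<noteq> 0"
    and "(\<lambda>l. fps_nth R l * poly (chebU l) x) sums (poly (chebIm A B) x / poly (chebRe B B) x)"
proof -
  define Rc where "Rc = Abs_fps (\<lambda>l. complex_of_real (fps_nth R l))"
  note Rc = fps_quotient_beyond_unit_disk[OF R nz, folded Rc_def]
  have den: "poly (chebRe B B) y \<noteq> 0" if "y \<in> {-1..1}" for y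
    using poly_chebRe_self[of B "arccos y"] nz[of "cis (arccos y)"] that by simp
  then show "poly (chebRe B B) x \<noteq> 0" using x by blast
  \<comment> \<open>The factor \<open>l\<close> that the bound on \<open>chebU l\<close> costs comes from differentiating the power series.\<close>
  have "ereal (cmod 1) < fps_conv_radius (fps_deriv Rc)"
    using Rc(1) fps_conv_radius_deriv[of Rc] by (simp add: one_ereal_def[symmetric])
  then have "summable (\<lambda>l. norm (fps_nth (fps_deriv Rc) l * 1 ^ l))"
    by (rule norm_summable_fps)
  then have "summable (\<lambda>l. real (Suc l) * \<bar>fps_nth R (Suc l)\<bar>)"
    by (simp add: Rc_def norm_mult del: of_nat_Suc)
  then have sum: "summable (\<lambda>l. real l * \<bar>fps_nth R l\<bar>)"
    by (subst (asm) summable_Suc_iff)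
  have bound: "norm (fps_nth R l * poly (chebU l) y) \<le> real l * \<bar>fps_nth R l\<bar>"
    if "y \<in> {-1..1}" for l y
    using mult_left_mono[OF abs_poly_chebU_le[OF that, of l], of "\<bar>fps_nth R l\<bar>"]
    by (simp add: abs_mult mult.commute)
  define s where "s = (\<lambda>y. \<Sum>l. fps_nth R l * poly (chebU l) y)"
  have sums: "(\<lambda>l. fps_nth R l * poly (chebU l) y) sums s y" if "y \<in> {-1..1}" for y
    unfolding s_def using summable_comparison_test'[OF sum bound[OF that]] by (rule summable_sums)
  have cont: "continuous_on {-1..1} s"
    unfolding s_def
    by (rule uniform_limit_theorem[OF _ Weierstrass_m_test[OF bound sum]])
      (auto intro!: always_eventually continuous_intros)
  have interior: "s y - poly (chebIm A B) y / poly (chebRe B B) y = 0"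
    if y: "y \<in> {-1<..<1}" for y
  proof -
    define t where "t = arccos y"
    have t: "cos t = y" "sin t > 0"
      using y arccos_lt_bounded[of y] by (auto simp: t_def intro: sin_gt_zero)
    let ?z = "cis t"
    have "ereal (cmod ?z) < fps_conv_radius Rc" using Rc(1) by (simp add: one_ereal_def[symmetric])
    from sums_eval_fps[OF this] have "(\<lambda>l. Im (fps_nth Rc l * ?z ^ l)) sums Im (eval_fps Rc ?z)"
      by (rule sums_Im)
    moreover have "Im (fps_nth Rc l * ?z ^ l) = sin t * (fps_nth R l * poly (chebU l) y)" for l
      using sin_mult_poly_chebU_cos[of t l] by (simp add: Rc_def Complex.DeMoivre t mult.left_commute)
    ultimately have "(\<lambda>l. sin t * (fps_nth R l * poly (chebU l) y)) sums Im (eval_fps Rc ?z)"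
      by simp
    moreover have "(\<lambda>l. sin t * (fps_nth R l * poly (chebU l) y)) sums (sin t * s y)"
      using sums[of y] y by (intro sums_mult) auto
    ultimately have "sin t * s y = Im (eval_fps Rc ?z)"
      by (rule sums_unique2[symmetric])
    moreover have "cpoly A ?z * cnj (cpoly B ?z) = eval_fps Rc ?z * of_real (poly (chebRe B B) y)"
      using Rc(2)[of ?z] poly_chebRe_self[of B t]
      by (simp add: t complex_norm_square mult.assoc del: of_real_power flip: of_real_power)
    then have "sin t * poly (chebIm A B) y = Im (eval_fps Rc ?z) * poly (chebRe B B) y"
      using poly_chebIm[of t A B] by (simp add: t)
    ultimately have "sin t * poly (chebIm A B) y = sin t * (s y * poly (chebRe B B) y)" by simp
    then show ?thesis using t(2) den[of y] y by (simp add: field_simps)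
  qed
  have "s x - poly (chebIm A B) x / poly (chebRe B B) x = 0"
    by (rule continuous_constant_on_closure[of "{-1<..<1}"])
      (use cont den x interior in \<open>auto intro!: continuous_intros\<close>)
  then show "(\<lambda>l. fps_nth R l * poly (chebU l) x) sums (poly (chebIm A B) x / poly (chebRe B B) x)"
    using sums[OF x] by simp
qed

lemma tendsto_quotient_common_factor:
  fixes p q S :: "real poly"
  assumes "S \<noteq> 0" "poly q x \<noteq> 0"
  shows "((\<lambda>t. poly (S * p) t / poly (S * q) t) \<longlongrightarrow> poly p x / poly q x) (at x)"
proof -
  have "((\<lambda>t. poly p t / poly q t) \<longlongrightarrow> poly p x / poly q x) (at x)"
    using assms(2) by (intro tendsto_intros)
  moreover have "\<forall>\<^sub>F t in at x. poly S t \<noteq> 0"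
    using islimpt_finite[OF poly_roots_finite[OF assms(1)], of x] by (simp add: islimpt_iff_eventually)
  then have "\<forall>\<^sub>F t in at x. poly p t / poly q t = poly (S * p) t / poly (S * q) t"
    by eventually_elim simp
  ultimately show ?thesis by (rule Lim_transform_eventually)
qed

text \<open>
  The previous series for \<open>P / Q\<close> without assuming lowest terms.  The limit \<open>v\<close> stands for
  the value at \<open>x\<close>, where numerator and denominator may both vanish.
\<close>

lemma reduced_quotient_chebU_series:
  assumes "Q \<noteq> 0" and R: "R * fps_of_poly Q = fps_of_poly P"
    and no_poles: "\<And>z. cmod z \<le> 1 \<Longrightarrow> \<not> is_pole (\<lambda>w. cpoly P w / cpoly Q w) z"
    and x: "x \<in> {-1..1}"
  obtains v where "((\<lambda>t. poly (chebIm P Q) t / poly (chebRe Q Q) t) \<longlongrightarrow> v) (at x)"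
    and "(\<lambda>l. fps_nth R l * poly (chebU l) x) sums v"
proof -
  define S A B where "S = gcd P Q" "A = P div S" "B = Q div S"
  have S: "S \<noteq> 0" "P = S * A" "Q = S * B" "coprime A B"
    using \<open>Q \<noteq> 0\<close> div_gcd_coprime[of P Q] by (simp_all add: S_A_B_def)
  then have "B \<noteq> 0" using \<open>Q \<noteq> 0\<close> by auto
  have "fps_of_poly S * (R * fps_of_poly B) = fps_of_poly S * fps_of_poly A"
    using R by (simp add: S fps_of_poly_mult mult_ac)
  then have RB: "R * fps_of_poly B = fps_of_poly A" using S(1) by simp
  have nz: "cpoly B z \<noteq> 0" if "cmod z \<le> 1" for z
    using no_pole_imp_reduced_denominator_neq_0[OF S(4,1) \<open>B \<noteq> 0\<close>] no_poles[OF that] S by simp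
  note series = chebU_series_of_quotient[OF RB nz x]
  show ?thesis
  proof (rule that)
    show "((\<lambda>t. poly (chebIm P Q) t / poly (chebRe Q Q) t)
        \<longlongrightarrow> poly (chebIm A B) x / poly (chebRe B B) x) (at x)"
      unfolding S(2,3) chebIm_mult chebRe_mult
      using chebRe_self_neq_0[OF S(1)] series(1) by (rule tendsto_quotient_common_factor)
  qed (rule series(2))
qed

section \<open>From Hermite-Jacobi to Hermite-Chebyshev approximations\<close>

lemma hermite_jacobi_imp_hermite_pade:
  assumes "hermite_jacobi k n ms f Q P"
  shows "hermite_pade k n ms f Q P"
  unfolding hermite_pade_def
proof (intro conjI ballI)
  show "Q \<noteq> 0" "degree Q \<le> msum k ms" using assms by (simp_all add: hermite_jacobi_def)
  fix j assume j: "j \<in> {1..k}"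
  then show "degree (P j) \<le> numdeg k n ms j" using assms by (simp add: hermite_jacobi_def)
  obtain g where g: "fps_to_fls (f j) - fps_to_fls (fps_of_poly (P j)) / fps_to_fls (fps_of_poly Q)
      = fps_to_fls (fps_X ^ (n + msum k ms + 1) * g)"
    using assms j unfolding hermite_jacobi_def by blast
  have Q0: "fps_to_fls (fps_of_poly Q) \<noteq> 0" using \<open>Q \<noteq> 0\<close> by simp
  have "fps_to_fls (fps_of_poly Q * f j - fps_of_poly (P j))
      = fps_to_fls (fps_of_poly Q) * (fps_to_fls (f j)
          - fps_to_fls (fps_of_poly (P j)) / fps_to_fls (fps_of_poly Q))"
    using Q0 by (simp add: fls_times_fps_to_fls right_diff_distrib)
  also have "\<dots> = fps_to_fls (fps_X ^ (n + msum k ms + 1) * (fps_of_poly Q * g))"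
    unfolding g by (simp only: fls_times_fps_to_fls mult_ac)
  finally show "\<exists>g. fps_of_poly Q * f j - fps_of_poly (P j) = fps_X ^ (n + msum k ms + 1) * g"
    by (simp only: fps_to_fls_eq_iff) blast
qed

text \<open>
  The Hermite-Jacobi condition forces \<open>P j / Q\<close>, a priori a Laurent series, to be a power
  series \<open>R\<close>, even if \<open>Q\<close> vanishes at \<open>0\<close>.
\<close>

lemma hermite_jacobi_quotient_series:
  assumes HJ: "hermite_jacobi k n ms f Q P" and j: "j \<in> {1..k}"
  obtains R where "R * fps_of_poly Q = fps_of_poly (P j)"
    and "\<And>l. l \<le> n + msum k ms \<Longrightarrow> fps_nth R l = fps_nth (f j) l"
proof -
  obtain g where g: "fps_to_fls (f j) - fps_to_fls (fps_of_poly (P j)) / fps_to_fls (fps_of_poly Q)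
      = fps_to_fls (fps_X ^ (n + msum k ms + 1) * g)"
    using HJ j unfolding hermite_jacobi_def by blast
  have "Q \<noteq> 0" using HJ by (simp add: hermite_jacobi_def)
  then have Q0: "fps_to_fls (fps_of_poly Q) \<noteq> 0" by simp
  define R where "R = f j - fps_X ^ (n + msum k ms + 1) * g"
  have "fps_to_fls R = fps_to_fls (fps_of_poly (P j)) / fps_to_fls (fps_of_poly Q)"
    using g unfolding R_def fps_to_fls_minus by (simp add: algebra_simps)
  then have "fps_to_fls (R * fps_of_poly Q) = fps_to_fls (fps_of_poly (P j))"
    using Q0 by (simp add: fls_times_fps_to_fls)
  then have "R * fps_of_poly Q = fps_of_poly (P j)" by (simp only: fps_to_fls_eq_iff)
  moreover have "fps_nth R l = fps_nth (f j) l" if "l \<le> n + msum k ms" for l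
    using that unfolding R_def fps_sub_nth fps_X_power_mult_nth by simp
  ultimately show ?thesis by (rule that)
qed

text \<open>
  The error is \<open>\<Sum>l. (b\<^sub>l - r\<^sub>l) U\<^sub>l\<close> with \<open>r\<^sub>l\<close> the coefficients of \<open>P\<^sub>j/Q\<close>, and
  \<open>r\<^sub>l = b\<^sub>l\<close> as long as \<open>l \<le> n + m\<close>.
\<close>

lemma hermite_chebyshev2_chebRe_chebIm:
  assumes fch: "\<forall>j\<in>{1..k}. \<forall>x\<in>{-1..1}.
                  (\<lambda>l. b j (Suc l) * poly (chebU (Suc l)) x) sums fch j x"
    and f: "\<And>j l. j \<in> {1..k} \<Longrightarrow> l \<ge> 1 \<Longrightarrow> fps_nth (f j) l = b j l"
    and HJ: "hermite_jacobi k n ms f Q P"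
    and no_poles: "\<forall>j\<in>{1..k}. \<forall>z. cmod z \<le> 1 \<longrightarrow> \<not> is_pole (\<lambda>w. cpoly (P j) w / cpoly Q w) z"
    and n: "\<And>j. j \<in> {1..k} \<Longrightarrow> ms j \<le> n"
  shows "hermite_chebyshev2 k n ms fch (chebRe Q Q) (\<lambda>j. chebIm (P j) Q)"
  unfolding hermite_chebyshev2_def
proof (intro conjI ballI)
  define N where "N = n + msum k ms"
  have Q: "Q \<noteq> 0" "degree Q \<le> msum k ms" using HJ by (simp_all add: hermite_jacobi_def)
  show "chebRe Q Q \<noteq> 0" using Q(1) by (rule chebRe_self_neq_0)
  show "degree (chebRe Q Q) \<le> msum k ms" using degree_chebRe[of Q Q] Q(2) by simp
  fix j assume j: "j \<in> {1..k}"
  have "degree (P j) \<le> numdeg k n ms j" using HJ j by (simp add: hermite_jacobi_def)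
  moreover have "degree Q \<le> numdeg k n ms j" using Q(2) n[OF j] by (simp add: numdeg_def)
  ultimately show "degree (chebIm (P j) Q) \<le> numdeg k n ms j"
    using degree_chebIm[of "P j" Q] by simp
  obtain R where R: "R * fps_of_poly Q = fps_of_poly (P j)"
    and R_eq: "\<And>l. l \<le> N \<Longrightarrow> fps_nth R l = fps_nth (f j) l"
    using hermite_jacobi_quotient_series[OF HJ j] unfolding N_def by blast
  define c where "c = (\<lambda>l. b j l - fps_nth R l)"
  show "\<exists>c. \<forall>x\<in>{-1..1}. \<exists>v.
      ((\<lambda>t. poly (chebIm (P j) Q) t / poly (chebRe Q Q) t) \<longlongrightarrow> v) (at x) \<and>
      (\<lambda>i. let l = n + msum k ms + 1 + i in c l * poly (chebU l) x) sums (fch j x - v)"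
  proof (intro exI[of _ c] ballI)
    fix x :: real assume x: "x \<in> {-1..1}"
    have no_pole: "\<not> is_pole (\<lambda>w. cpoly (P j) w / cpoly Q w) z" if "cmod z \<le> 1" for z
      using no_poles j that by blast
    obtain v where v: "((\<lambda>t. poly (chebIm (P j) Q) t / poly (chebRe Q Q) t) \<longlongrightarrow> v) (at x)"
      and "(\<lambda>l. fps_nth R l * poly (chebU l) x) sums v"
      using reduced_quotient_chebU_series[OF Q(1) R no_pole x] by blast
    then have "(\<lambda>l. fps_nth R (Suc l) * poly (chebU (Suc l)) x) sums v"
      by (subst sums_Suc_iff) simp
    moreover have "(\<lambda>l. b j (Suc l) * poly (chebU (Suc l)) x) sums fch j x"
      using fch j x by blast
    ultimately have "(\<lambda>l. c (Suc l) * poly (chebU (Suc l)) x) sums (fch j x - v)"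
      unfolding c_def left_diff_distrib by (rule sums_diff[rotated])
    then have "(\<lambda>i. c (Suc (i + N)) * poly (chebU (Suc (i + N))) x) sums (fch j x - v)"
      by (subst sums_zero_iff_shift[where f = "\<lambda>l. c (Suc l) * poly (chebU (Suc l)) x"])
        (simp_all add: c_def R_eq f[OF j])
    then show "\<exists>v. ((\<lambda>t. poly (chebIm (P j) Q) t / poly (chebRe Q Q) t) \<longlongrightarrow> v) (at x) \<and>
      (\<lambda>i. let l = n + msum k ms + 1 + i in c l * poly (chebU l) x) sums (fch j x - v)"
      using v by (intro exI[of _ v]) (simp add: N_def add_ac)
  qed
qed

section \<open>Determinant formulas for Hermite-Pade polynomials\<close>

text \<open>
  Cramer's rule for the last unknown.  The column that it substitutes, \<open>M *\<^sub>v x\<close>, is zero except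
  possibly in its last entry, so the expansion along it has a single term.
\<close>

lemma last_entry_mult_det:
  fixes M :: "'a::idom mat"
  assumes M: "M \<in> carrier_mat (Suc m) (Suc m)" and x: "x \<in> carrier_vec (Suc m)"
    and zero: "\<And>i. i < m \<Longrightarrow> vec_index (M *\<^sub>v x) i = 0"
  shows "vec_index x m * Determinant.det M
    = vec_index (M *\<^sub>v x) m * Determinant.det (mat m m (\<lambda>(i, c). M $$ (i, c)))"
proof -
  define N where "N = replace_col M (M *\<^sub>v x) m"
  have N: "N \<in> carrier_mat (Suc m) (Suc m)"
    using M by (auto simp: N_def replace_col_def)
  have col: "N $$ (i, m) = vec_index (M *\<^sub>v x) i" if "i \<le> m" for i
    using that M by (simp add: N_def replace_col_def)
  have del: "mat_delete N m m = mat m m (\<lambda>(i, c). M $$ (i, c))"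
    using M by (intro eq_matI) (auto simp: N_def replace_col_def mat_delete_def)
  have "vec_index x m * Determinant.det M = Determinant.det N"
    unfolding N_def using M x by (intro cramer_lemma_mat [symmetric]) auto
  also have "\<dots> = (\<Sum>i<Suc m. N $$ (i, m) * cofactor N i m)"
    using N by (intro laplace_expansion_column) auto
  also have "\<dots> = vec_index (M *\<^sub>v x) m * cofactor N m m"
    using zero by (simp add: col)
  also have "cofactor N m m = Determinant.det (mat m m (\<lambda>(i, c). M $$ (i, c)))"
    by (simp add: cofactor_def del)
  finally show ?thesis .
qed

text \<open>
  The nested comprehension in \<open>coeff_rows\<close> flattened to one list, so that a single row number
  determines the block \<open>j\<close> and the row \<open>r\<close> inside it.
\<close>

definition row_index :: "nat \<Rightarrow> (nat \<Rightarrow> nat) \<Rightarrow> (nat \<times> nat) list" where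
  "row_index k ms = concat (map (\<lambda>j. map (Pair j) [1..<ms j + 1]) [1..<k + 1])"

lemma length_row_index: "length (row_index k ms) = msum k ms"
proof -
  have "length (row_index k ms) = sum_list (map ms [1..<k + 1])"
    by (simp add: row_index_def length_concat comp_def del: upt_Suc)
  also have "\<dots> = msum k ms"
    unfolding msum_def by (simp add: interv_sum_list_conv_sum_set_nat atLeastLessThanSuc_atLeastAtMost del: upt_Suc)
  finally show ?thesis .
qed

lemma set_row_index: "set (row_index k ms) = (SIGMA j:{1..k}. {1..ms j})"
  by (force simp: row_index_def simp del: upt_Suc)

lemma coeff_rows_conv_row_index:
  "coeff_rows k n ms f w = map (\<lambda>(j, r). map (\<lambda>c.
     fls_nth (fps_to_fls (f j)) (int n - int (ms j) + int r + int c)) [0..<w]) (row_index k ms)"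
  by (simp add: coeff_rows_def row_index_def map_concat comp_def del: upt_Suc)

text \<open>
  \<open>last_entry_mult_det\<close> for the bordered matrix over the ring of polynomials.  The minor left
  after deleting the last row and the last column is \<open>H_det\<close>.
\<close>

lemma bordered_det_kernel_vector:
  fixes x :: "nat \<Rightarrow> real"
  assumes kernel: "\<And>j r. j \<in> {1..k} \<Longrightarrow> r \<in> {1..ms j} \<Longrightarrow>
      (\<Sum>c\<le>msum k ms. x c * fls_nth (fps_to_fls (f j)) (int n - int (ms j) + int r + int c)) = 0"
    and e: "length e = Suc (msum k ms)"
  shows "Polynomial.smult (x (msum k ms)) (bordered_det k n ms f e)
    = Polynomial.smult (H_det k n ms f) (\<Sum>c\<le>msum k ms. Polynomial.smult (x c) (e ! c))"
proof -
  define m where "m = msum k ms"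
  define I where "I = row_index k ms"
  define a where "a = (\<lambda>i c. case I ! i of (j, r) \<Rightarrow>
    fls_nth (fps_to_fls (f j)) (int n - int (ms j) + int r + int c))"
  have len: "length I = m" by (simp add: I_def m_def length_row_index)
  have rows: "coeff_rows k n ms f w ! i ! c = a i c" and rows_len: "length (coeff_rows k n ms f w ! i) = w"
    if "i < m" "c < w" for i c w
    using that len by (simp_all add: coeff_rows_conv_row_index I_def [symmetric] a_def split: prod.splits)
  have len_rows: "length (coeff_rows k n ms f w) = m" for w
    using len by (simp add: coeff_rows_conv_row_index I_def)
  define M where "M = mat_of_rows_list (m + 1)
    (map (map (\<lambda>a. [:a:])) (coeff_rows k n ms f (m + 1)) @ [e])"
  define v where "v = vec (Suc m) (\<lambda>c. [:x c:])"
  have M: "M \<in> carrier_mat (Suc m) (Suc m)"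
    by (simp add: M_def mat_of_rows_list_def len_rows)
  have v: "v \<in> carrier_vec (Suc m)" by (simp add: v_def)
  have M_top: "M $$ (i, c) = [:a i c:]" if "i < m" "c < Suc m" for i c
    using that rows[of i c "Suc m"] rows_len[of i c "Suc m"]
    by (simp add: M_def mat_of_rows_list_def len_rows nth_append)
  have M_last: "M $$ (m, c) = e ! c" if "c < Suc m" for c
    using that by (simp add: M_def mat_of_rows_list_def len_rows nth_append)
  have prod: "vec_index (M *\<^sub>v v) i = (\<Sum>c\<le>m. M $$ (i, c) * [:x c:])" if "i < Suc m" for i
    using that M by (simp add: v_def scalar_prod_def atLeast0LessThan lessThan_Suc_atMost)
  have "vec_index (M *\<^sub>v v) i = 0" if "i < m" for i
  proof -
    obtain j r where jr: "I ! i = (j, r)" by fastforce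
    have "(j, r) \<in> set I" using jr that len by (metis nth_mem)
    then have "j \<in> {1..k}" "r \<in> {1..ms j}" by (simp_all add: I_def set_row_index)
    then have "(\<Sum>c\<le>m. a i c * x c) = 0"
      using kernel[of j r] by (simp add: a_def jr m_def mult.commute)
    moreover have "vec_index (M *\<^sub>v v) i = (\<Sum>c\<le>m. [:a i c * x c:])"
      using that by (simp add: prod M_top mult.commute)
    moreover have "(\<Sum>c\<le>m. [:a i c * x c:]) = [:\<Sum>c\<le>m. a i c * x c:]"
      by (induction m) simp_all
    ultimately show ?thesis by simp
  qed
  from last_entry_mult_det[OF M v this]
  have cramer: "[:x m:] * Determinant.det M = (\<Sum>c\<le>m. e ! c * [:x c:])
      * Determinant.det (mat m m (\<lambda>(i, c). M $$ (i, c)))"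
    by (simp add: v_def [symmetric] prod M_last) (simp add: v_def)
  interpret const: comm_ring_hom "\<lambda>c::real. [:c:]"
    by unfold_locales (auto simp: one_pCons)
  have "mat m m (\<lambda>(i, c). M $$ (i, c))
      = map_mat (\<lambda>c. [:c:]) (mat_of_rows_list m (coeff_rows k n ms f m))"
    by (intro eq_matI) (auto simp: mat_of_rows_list_def len_rows M_top rows)
  then have "Determinant.det (mat m m (\<lambda>(i, c). M $$ (i, c))) = [:H_det k n ms f:]"
    by (simp only: const.hom_det H_det_def m_def)
  then show ?thesis
    using cramer by (simp add: bordered_det_def m_def [symmetric] mult.commute flip: M_def [simplified])
qed

text \<open>
  The Cauchy product arranged as in the matrices, with column \<open>c\<close> carrying the coefficient of
  \<open>Q\<close> at \<open>m - c\<close>.  Since \<open>fls_nth\<close> vanishes at negative indices, the sum runs over all columns for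
  every \<open>p\<close>.
\<close>

lemma fps_nth_fps_of_poly_mult:
  fixes Q :: "'a::comm_ring_1 poly"
  assumes "degree Q \<le> m"
  shows "fps_nth (fps_of_poly Q * f) p
    = (\<Sum>c\<le>m. coeff Q (m - c) * fls_nth (fps_to_fls f) (int p - int (m - c)))"
proof -
  have "fps_nth (fps_of_poly Q * f) p = (\<Sum>i\<in>{0..p}. coeff Q i * fps_nth f (p - i))"
    by (simp add: fps_mult_nth)
  also have "\<dots> = (\<Sum>i\<in>{..m}. coeff Q i * fls_nth (fps_to_fls f) (int p - int i))"
    by (rule sum.mono_neutral_cong)
      (use assms in \<open>auto simp: coeff_eq_0 nat_diff_distrib\<close>)
  also have "\<dots> = (\<Sum>c\<in>{..m}. coeff Q (m - c) * fls_nth (fps_to_fls f) (int p - int (m - c)))"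
    by (rule sum.reindex_bij_witness[of _ "\<lambda>c. m - c" "\<lambda>c. m - c"]) auto
  finally show ?thesis .
qed

lemma hermite_pade_coeff:
  assumes HP: "hermite_pade k n ms f Q P" and j: "j \<in> {1..k}" and p: "p \<le> n + msum k ms"
  shows "(\<Sum>c\<le>msum k ms. coeff Q (msum k ms - c)
     * fls_nth (fps_to_fls (f j)) (int p - int (msum k ms - c))) = coeff (P j) p"
proof -
  obtain g where g: "fps_of_poly Q * f j - fps_of_poly (P j) = fps_X ^ (n + msum k ms + 1) * g"
    using HP j unfolding hermite_pade_def by blast
  have "fps_nth (fps_of_poly Q * f j - fps_of_poly (P j)) p = 0"
    unfolding g using p by (simp only: fps_X_power_mult_nth) simp
  moreover have "degree Q \<le> msum k ms" using HP unfolding hermite_pade_def by blast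
  ultimately show ?thesis by (simp add: fps_nth_fps_of_poly_mult)
qed

text \<open>
  The coefficients of \<open>Q\<close> satisfy the linear system because the coefficients of \<open>Q * f j\<close>
  above \<open>numdeg k n ms j\<close> and up to \<open>n + m\<close> vanish, \<open>P j\<close> having too small a degree.  Cramer's rule then
  gives \<open>Q(0) D = H Q\<close> and \<open>Q(0) G\<^sub>j = H P\<^sub>j\<close>.  If \<open>Q(0)\<close> were \<open>0\<close>, the first of these would
  give \<open>Q = 0\<close>.
\<close>

lemma hermite_pade_determinants:
  assumes HP: "hermite_pade k n ms f Q P" and n: "\<And>j. j \<in> {1..k} \<Longrightarrow> ms j \<le> n"
    and H: "H_det k n ms f \<noteq> 0"
  shows "\<exists>a. a \<noteq> 0 \<and> Q = Polynomial.smult a (D_det k n ms f) \<and>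
           (\<forall>j\<in>{1..k}. P j = Polynomial.smult a (G_det k n ms f j))"
proof -
  define m where "m = msum k ms"
  define x where "x = (\<lambda>c. coeff Q (m - c))"
  have Q: "Q \<noteq> 0" "degree Q \<le> m" and P: "\<And>j. j \<in> {1..k} \<Longrightarrow> degree (P j) \<le> n + m - ms j"
    using HP by (auto simp: hermite_pade_def m_def numdeg_def)
  note coeff_P = hermite_pade_coeff[OF HP, folded m_def]
  have kernel: "(\<Sum>c\<le>m. x c * fls_nth (fps_to_fls (f j)) (int n - int (ms j) + int r + int c)) = 0"
    if j: "j \<in> {1..k}" and r: "r \<in> {1..ms j}" for j r
  proof -
    \<comment> \<open>Row \<open>r\<close> of block \<open>j\<close> is the coefficient at the power \<open>n\<^sub>j + r\<close>.\<close>
    define p where "p = n + m - ms j + r"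
    have "(\<Sum>c\<le>m. x c * fls_nth (fps_to_fls (f j)) (int p - int (m - c))) = coeff (P j) p"
      unfolding x_def using r n[OF j] by (intro coeff_P j) (auto simp: p_def)
    also have "\<dots> = 0"
      using P[OF j] r by (intro coeff_eq_0) (auto simp: p_def)
    finally have *: "(\<Sum>c\<le>m. x c * fls_nth (fps_to_fls (f j)) (int p - int (m - c))) = 0" .
    have index: "int n - int (ms j) + int r + int c = int p - int (m - c)" if "c \<le> m" for c
      using n[OF j] that by (simp add: p_def of_nat_diff)
    have "(\<Sum>c\<le>m. x c * fls_nth (fps_to_fls (f j)) (int n - int (ms j) + int r + int c))
        = (\<Sum>c\<le>m. x c * fls_nth (fps_to_fls (f j)) (int p - int (m - c)))"
      by (intro sum.cong refl) (simp only: index atMost_iff)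
    with * show ?thesis by simp
  qed
  note cramer = bordered_det_kernel_vector[of k ms x f n, folded m_def, OF kernel]
  have "Polynomial.smult (x m) (D_det k n ms f)
      = Polynomial.smult (H_det k n ms f) (\<Sum>c\<le>m. Polynomial.smult (x c) (monom 1 (m - c)))"
    unfolding D_det_def m_def [symmetric] by (subst cramer) (simp_all del: upt_Suc)
  also have "(\<Sum>c\<le>m. Polynomial.smult (x c) (monom 1 (m - c))) = (\<Sum>c\<le>m. monom (coeff Q c) c)"
    by (rule sum.reindex_bij_witness[of _ "\<lambda>c. m - c" "\<lambda>c. m - c"]) (auto simp: x_def smult_monom)
  also have "\<dots> = Q" using Q(2) by (rule poly_as_sum_of_monoms')
  finally have D: "Polynomial.smult (x m) (D_det k n ms f) = Polynomial.smult (H_det k n ms f) Q" .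
  have G: "Polynomial.smult (x m) (G_det k n ms f j) = Polynomial.smult (H_det k n ms f) (P j)"
    if j: "j \<in> {1..k}" for j
  proof -
    define L where "L = (\<lambda>c. {l. int l \<le> int n - int (ms j) + int c})"
    have L: "L c = {..n - ms j + c}" for c
      using n[OF j] by (auto simp: L_def)
    have "Polynomial.smult (x m) (G_det k n ms f j) = Polynomial.smult (H_det k n ms f)
        (\<Sum>c\<le>m. Polynomial.smult (x c) (\<Sum>l\<in>L c. monom (fps_nth (f j) l) (m - c + l)))"
      unfolding G_det_def m_def [symmetric] L_def by (subst cramer) (simp_all del: upt_Suc)
    also have "(\<Sum>c\<le>m. Polynomial.smult (x c) (\<Sum>l\<in>L c. monom (fps_nth (f j) l) (m - c + l))) = P j"
    proof (rule poly_eqI)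
      fix p
      \<comment> \<open>The truncation of the entries in column \<open>c\<close> is exactly the restriction to powers \<open>p \<le> n\<^sub>j\<close>.\<close>
      have entry: "coeff (\<Sum>l\<in>L c. monom (fps_nth (f j) l) (m - c + l)) p
          = (if p \<le> n + m - ms j then fls_nth (fps_to_fls (f j)) (int p - int (m - c)) else 0)"
        if c: "c \<le> m" for c
      proof -
        have "coeff (\<Sum>l\<in>L c. monom (fps_nth (f j) l) (m - c + l)) p
            = (\<Sum>l\<in>L c. if l = p - (m - c) \<and> m - c \<le> p then fps_nth (f j) l else 0)"
          unfolding coeff_sum coeff_monom by (intro sum.cong refl if_cong) auto
        also have "\<dots> = (if p - (m - c) \<in> L c \<and> m - c \<le> p then fps_nth (f j) (p - (m - c)) else 0)"
          by (cases "m - c \<le> p") (simp_all add: L)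
        also have "\<dots> = (if p \<le> n + m - ms j then fls_nth (fps_to_fls (f j)) (int p - int (m - c)) else 0)"
          using n[OF j] c by (auto simp: L nat_diff_distrib)
        finally show ?thesis .
      qed
      have "coeff (\<Sum>c\<le>m. Polynomial.smult (x c) (\<Sum>l\<in>L c. monom (fps_nth (f j) l) (m - c + l))) p
          = (\<Sum>c\<le>m. x c * (if p \<le> n + m - ms j
              then fls_nth (fps_to_fls (f j)) (int p - int (m - c)) else 0))"
        unfolding coeff_sum[of _ "{..m}"] coeff_smult
        by (intro sum.cong refl) (simp only: entry atMost_iff)
      also have "\<dots> = (if p \<le> n + m - ms j
             then \<Sum>c\<le>m. x c * fls_nth (fps_to_fls (f j)) (int p - int (m - c)) else 0)"
        by simp
      also have "\<dots> = coeff (P j) p"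
        using coeff_P[OF j, of p] P[OF j] by (auto simp: x_def coeff_eq_0)
      finally show "coeff (\<Sum>c\<le>m. Polynomial.smult (x c)
          (\<Sum>l\<in>L c. monom (fps_nth (f j) l) (m - c + l))) p = coeff (P j) p" .
    qed
    finally show ?thesis .
  qed
  have "x m \<noteq> 0" using D H Q(1) by auto
  define a where "a = x m / H_det k n ms f"
  have solve: "q = Polynomial.smult a p"
    if "Polynomial.smult (x m) p = Polynomial.smult (H_det k n ms f) q" for p q
  proof -
    have "q = Polynomial.smult (1 / H_det k n ms f) (Polynomial.smult (H_det k n ms f) q)"
      using H by simp
    then show ?thesis unfolding that [symmetric] by (simp add: a_def)
  qed
  have "a \<noteq> 0" using \<open>x m \<noteq> 0\<close> H by (simp add: a_def)
  then show ?thesis using solve[OF D] solve[OF G] by blast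
qed

section \<open>Existence and representation of the approximations\<close>

theorem theorem4:
  fixes k n :: nat
    and ms :: "nat \<Rightarrow> nat"
    and b :: "nat \<Rightarrow> nat \<Rightarrow> real"
    and fch :: "nat \<Rightarrow> real \<Rightarrow> real"
    and f2 :: "nat \<Rightarrow> real fps"
    and Q :: "real poly"
    and P :: "nat \<Rightarrow> real poly"
  assumes k: "k \<ge> 1"
    and m: "msum k ms \<noteq> 0"
    and n: "n \<ge> Max (ms ` {1..k})"
    and fch: "\<forall>j\<in>{1..k}. \<forall>x\<in>{-1..1}.
                (\<lambda>l. b j (Suc l) * poly (chebU (Suc l)) x) sums fch j x"
    and f2: "\<forall>j\<in>{1..k}. f2 j = Abs_fps (\<lambda>l. if l = 0 then 0 else b j l)"
    and HJ: "hermite_jacobi k n ms f2 Q P"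
    and radius: "\<forall>j\<in>{1..k}. fps_conv_radius (f2 j) > 1"
    and no_poles: "\<forall>j\<in>{1..k}. \<forall>z. cmod z \<le> 1 \<longrightarrow> \<not> is_pole (\<lambda>w. cpoly (P j) w / cpoly Q w) z"
  shows "(\<exists>Qch Pch. hermite_chebyshev2 k n ms fch Qch Pch \<and>
            (\<forall>x\<in>{-1..1}. complex_of_real (poly Qch x) =
               cpoly Q (cis (arccos x)) * cnj (cpoly Q (cis (arccos x)))) \<and>
            (\<forall>j\<in>{1..k}.
               (\<forall>x\<in>{-1<..<1}. poly (Pch j) x =
                  1 / sqrt (1 - x\<^sup>2) *
                    Im (cpoly (P j) (cis (arccos x)) * cnj (cpoly Q (cis (arccos x))))) \<and>
               (\<forall>x\<in>{-1, 1}.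
                  ((\<lambda>t. 1 / sqrt (1 - t\<^sup>2) *
                    Im (cpoly (P j) (cis (arccos t)) * cnj (cpoly Q (cis (arccos t)))))
                   \<longlongrightarrow> poly (Pch j) x) (at x within {-1<..<1})))) \<and>
         hermite_pade k n ms f2 Q P \<and>
         (H_det k n ms f2 \<noteq> 0 \<longrightarrow>
            (\<exists>a. a \<noteq> 0 \<and> Q = Polynomial.smult a (D_det k n ms f2) \<and>
               (\<forall>j\<in>{1..k}. P j = Polynomial.smult a (G_det k n ms f2 j))))"
proof (intro conjI impI)
  have ms_le: "ms j \<le> n" if "j \<in> {1..k}" for j
    using n that by (meson Max_ge finite_atLeastAtMost finite_imageI imageI le_trans)
  have coeffs: "fps_nth (f2 j) l = b j l" if "j \<in> {1..k}" "l \<ge> 1" for j l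
    using f2 that by simp
  show HP: "hermite_pade k n ms f2 Q P"
    using HJ by (rule hermite_jacobi_imp_hermite_pade)
  show "\<exists>a. a \<noteq> 0 \<and> Q = Polynomial.smult a (D_det k n ms f2) \<and>
      (\<forall>j\<in>{1..k}. P j = Polynomial.smult a (G_det k n ms f2 j))" if "H_det k n ms f2 \<noteq> 0"
    using HP ms_le that by (rule hermite_pade_determinants)
  show "\<exists>Qch Pch. hermite_chebyshev2 k n ms fch Qch Pch \<and>
            (\<forall>x\<in>{-1..1}. complex_of_real (poly Qch x) =
               cpoly Q (cis (arccos x)) * cnj (cpoly Q (cis (arccos x)))) \<and>
            (\<forall>j\<in>{1..k}.
               (\<forall>x\<in>{-1<..<1}. poly (Pch j) x =
                  1 / sqrt (1 - x\<^sup>2) *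
                    Im (cpoly (P j) (cis (arccos x)) * cnj (cpoly Q (cis (arccos x))))) \<and>
               (\<forall>x\<in>{-1, 1}.
                  ((\<lambda>t. 1 / sqrt (1 - t\<^sup>2) *
                    Im (cpoly (P j) (cis (arccos t)) * cnj (cpoly Q (cis (arccos t)))))
                   \<longlongrightarrow> poly (Pch j) x) (at x within {-1<..<1})))"
  proof (intro exI conjI ballI)
    show "hermite_chebyshev2 k n ms fch (chebRe Q Q) (\<lambda>j. chebIm (P j) Q)"
      using fch coeffs HJ no_poles ms_le by (rule hermite_chebyshev2_chebRe_chebIm)
  next
    fix x :: real assume "x \<in> {-1..1}"
    then show "complex_of_real (poly (chebRe Q Q) x)
        = cpoly Q (cis (arccos x)) * cnj (cpoly Q (cis (arccos x)))"
      using poly_chebRe_self[of Q "arccos x"] by (simp add: complex_norm_square flip: of_real_power)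
  next
    fix j and x :: real assume "x \<in> {-1<..<1}"
    then show "poly (chebIm (P j) Q) x = 1 / sqrt (1 - x\<^sup>2) *
        Im (cpoly (P j) (cis (arccos x)) * cnj (cpoly Q (cis (arccos x))))"
      by (rule poly_chebIm_arccos)
  next
    fix j and x :: real
    have "((\<lambda>t. poly (chebIm (P j) Q) t) \<longlongrightarrow> poly (chebIm (P j) Q) x) (at x within {-1<..<1})"
      by (intro tendsto_intros)
    moreover have "\<forall>\<^sub>F t in at x within {-1<..<1}. poly (chebIm (P j) Q) t = 1 / sqrt (1 - t\<^sup>2) *
        Im (cpoly (P j) (cis (arccos t)) * cnj (cpoly Q (cis (arccos t))))"
      unfolding eventually_at_filter by (intro always_eventually allI impI poly_chebIm_arccos)
    ultimately show "((\<lambda>t. 1 / sqrt (1 - t\<^sup>2) *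
        Im (cpoly (P j) (cis (arccos t)) * cnj (cpoly Q (cis (arccos t)))))
        \<longlongrightarrow> poly (chebIm (P j) Q) x) (at x within {-1<..<1})"
      by (rule Lim_transform_eventually)
  qed
qed

end
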